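(* Let $X$ be a finite-dimensional Euclidean space, let $A,B\subset X$ be closed and convex, and let $\bar x\in A\cap B$. The following conditions are equivalent: (i) $\{A,B\}$ is intrinsically transversal at $\bar x$; (ii) $\{A,B\}$ is weakly intrinsically transversal at $\bar x$; (iii) $\{A,B\}$ is subtransversal at $\bar x$.
   Context: $X^*$ is identified with $X$ and $\langle\cdot,\cdot\rangle$ is the inner product. $\mathbb{B}_r(x)$ is the open ball with centre $x$ and radius $r$; $d(\cdot,\cdot)$ is the distance from a point to a set. Normal cone to a convex set $A$ at $x\in A$: $N_A(x)=\{v\in X\mid\langle v,a-x\rangle\le0\text{ for all }a\in A\}$. Subtransversality at $\bar x$: there exist $\alpha\in]0,1[$ and $\delta>0$ such that $\alpha\, d(x,A\cap B)\le\max\{d(x,A),d(x,B)\}$ for all $x\in\mathbb{B}_\delta(\bar x)$. Weak intrinsic transversality at $\bar x$: there exist $\alpha\in]0,1[$ and $\delta>0$ such that, for all $a\in(A\setminus B)\cap\mathbb{B}_\delta(\bar x)$, $b\in(B\setminus A)\cap\mathbb{B}_\delta(\bar x)$ and $x\in\mathbb{B}_\delta(\bar x)$ with $\|x-a\|=\|x-b\|$, there is an $\varepsilon>0$ such that $\|v_1+v_2\|>\alpha$ for all $a'\in A\cap\mathbb{B}_\varepsilon(a)$, $b'\in B\cap\mathbb{B}_\varepsilon(b)$, $x_1'\in\mathbb{B}_\varepsilon(a)$, $x_2'\in\mathbb{B}_\varepsilon(b)$ with $\|x-x_1'\|=\|x-x_2'\|$, and all $v_1,v_2\in X$ satisfying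 $d(v_1,N_A(a'))<\delta$, $d(v_2,N_B(b'))<\delta$, $\|v_1\|+\|v_2\|=1$, $\langle v_1,x-x_1'\rangle=\|v_1\|\|x-x_1'\|$, $\langle v_2,x-x_2'\rangle=\|v_2\|\|x-x_2'\|$. Intrinsic transversality at $\bar x$: there exist $\alpha\in]0,1[$ and $\delta>0$ such that $\|v_1+v_2\|>\alpha$ for all $a\in(A\setminus B)\cap\mathbb{B}_\delta(\bar x)$, $b\in(B\setminus A)\cap\mathbb{B}_\delta(\bar x)$, $x\in\mathbb{B}_\delta(\bar x)$ with $x\ne a$, $x\ne b$, $1-\delta<\frac{\|x-a\|}{\|x-b\|}<1+\delta$, and all $v_1\in N_A(a)\setminus\{0\}$, $v_2\in N_B(b)\setminus\{0\}$ satisfying $\|v_1\|+\|v_2\|=1$, $\frac{\langle v_1,x-a\rangle}{\|v_1\|\|x-a\|}>1-\delta$, $\frac{\langle v_2,x-b\rangle}{\|v_2\|\|x-b\|}>1-\delta$. *)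

theory Defs
  imports "HOL-Analysis.Analysis"
begin

text \<open>
  Only meaningful for \<open>x \<in> A\<close>; it is only ever used at such points below.
\<close>

definition normal_cone :: "'a::euclidean_space set \<Rightarrow> 'a \<Rightarrow> 'a set" where
  "normal_cone A x = {v. \<forall>a\<in>A. v \<bullet> (a - x) \<le> 0}"

definition subtransversal_at :: "'a::euclidean_space set \<Rightarrow> 'a set \<Rightarrow> 'a \<Rightarrow> bool" where
  "subtransversal_at A B p \<longleftrightarrow>
     (\<exists>\<alpha>\<in>{0<..<1}. \<exists>\<delta>>0. \<forall>x\<in>ball p \<delta>.
        \<alpha> * infdist x (A \<inter> B) \<le> max (infdist x A) (infdist x B))"

text \<open>
  The radius \<open>\<epsilon>\<close> may depend on \<open>a\<close>, \<open>b\<close> and \<open>x\<close>, unlike \<open>\<alpha>\<close> and \<open>\<delta>\<close>. The vectors \<open>v1\<close>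
  and \<open>v2\<close> need only be \<open>\<delta>\<close>-close to the normal cones, and one of them may be zero.
\<close>

definition weakly_intrinsically_transversal_at ::
    "'a::euclidean_space set \<Rightarrow> 'a set \<Rightarrow> 'a \<Rightarrow> bool" where
  "weakly_intrinsically_transversal_at A B p \<longleftrightarrow>
     (\<exists>\<alpha>\<in>{0<..<1}. \<exists>\<delta>>0.
        \<forall>a\<in>(A - B) \<inter> ball p \<delta>. \<forall>b\<in>(B - A) \<inter> ball p \<delta>. \<forall>x\<in>ball p \<delta>.
          norm (x - a) = norm (x - b) \<longrightarrow>
          (\<exists>\<epsilon>>0.
             \<forall>a'\<in>A \<inter> ball a \<epsilon>. \<forall>b'\<in>B \<inter> ball b \<epsilon>. \<forall>x1\<in>ball a \<epsilon>. \<forall>x2\<in>ball b \<epsilon>.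
               norm (x - x1) = norm (x - x2) \<longrightarrow>
               (\<forall>v1 v2.
                  infdist v1 (normal_cone A a') < \<delta> \<and> infdist v2 (normal_cone B b') < \<delta> \<and>
                  norm v1 + norm v2 = 1 \<and>
                  v1 \<bullet> (x - x1) = norm v1 * norm (x - x1) \<and>
                  v2 \<bullet> (x - x2) = norm v2 * norm (x - x2) \<longrightarrow>
                  norm (v1 + v2) > \<alpha>)))"

definition intrinsically_transversal_at ::
    "'a::euclidean_space set \<Rightarrow> 'a set \<Rightarrow> 'a \<Rightarrow> bool" where
  "intrinsically_transversal_at A B p \<longleftrightarrow>
     (\<exists>\<alpha>\<in>{0<..<1}. \<exists>\<delta>>0.
        \<forall>a\<in>(A - B) \<inter> ball p \<delta>. \<forall>b\<in>(B - A) \<inter> ball p \<delta>. \<forall>x\<in>ball p \<delta>.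
          x \<noteq> a \<and> x \<noteq> b \<and>
          1 - \<delta> < norm (x - a) / norm (x - b) \<and> norm (x - a) / norm (x - b) < 1 + \<delta> \<longrightarrow>
          (\<forall>v1\<in>normal_cone A a - {0}. \<forall>v2\<in>normal_cone B b - {0}.
             norm v1 + norm v2 = 1 \<and>
             (v1 \<bullet> (x - a)) / (norm v1 * norm (x - a)) > 1 - \<delta> \<and>
             (v2 \<bullet> (x - b)) / (norm v2 * norm (x - b)) > 1 - \<delta> \<longrightarrow>
             norm (v1 + v2) > \<alpha>))"

end

theory Submission
  imports Defs
begin

text \<open>
  All three conditions are equivalent to a fourth, \<open>equidistant_transversal_at\<close>: at a point \<open>x\<close>
  near \<open>p\<close> lying at the same positive distance from \<open>A\<close> and from \<open>B\<close>, the unit vectors pointing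
  to \<open>x\<close> from its projections \<open>a\<close> and \<open>b\<close> are uniformly far from being opposite. This condition
  is the restriction of both kinds of intrinsic transversality to exact normals, exact alignment
  and equal distances.

  The fourth condition gives subtransversality by a slope argument for
  \<open>f x = max (infdist x A) (infdist x B)\<close>. If \<open>f x\<^sub>0 < \<alpha> * infdist x\<^sub>0 (A \<inter> B)\<close>, a minimiser \<open>z\<close> of
  \<open>\<lambda>y. f y + \<alpha> * dist y x\<^sub>0\<close> lies too close to \<open>x\<^sub>0\<close> to belong to \<open>A \<inter> B\<close>, and \<open>f\<close> cannot decrease
  from \<open>z\<close> faster than at rate \<open>\<alpha>\<close>. But if one of the sets is strictly farther from \<open>z\<close>,
  walking towards it decreases \<open>f\<close> at rate 1 (\<open>slope_bound_imp_equal_infdist\<close>); and if both are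
  equally far, walking along \<open>-(u + w)\<close>, where \<open>u\<close> and \<open>w\<close> are the two unit vectors, decreases \<open>f\<close> at
  rate \<open>norm (u + w) / 2\<close> (\<open>slope_bound_imp_opposed\<close>), which the condition makes larger than \<open>\<alpha>\<close>.

  Conversely, under subtransversality let \<open>c\<close> be the point of \<open>A \<inter> B\<close> nearest to \<open>x\<close>. Normals \<open>v\<^sub>1\<close>
  at \<open>a\<close> and \<open>v\<^sub>2\<close> at \<open>b\<close> have nonpositive inner products with \<open>c - a\<close> and \<open>c - b\<close>. If they point
  roughly towards \<open>x\<close>, then \<open>(v\<^sub>1 + v\<^sub>2) \<bullet> (x - c)\<close> is bounded below by a multiple of the distance
  from \<open>x\<close> to \<open>a\<close> and \<open>b\<close>, whereas \<open>norm (x - c)\<close> is bounded above by such a multiple;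
  so \<open>v\<^sub>1 + v\<^sub>2\<close> cannot be small. This argument tolerates small errors in all the data, and thereby
  yields both kinds of intrinsic transversality.
\<close>

definition equidistant_transversal_at :: "'a::euclidean_space set \<Rightarrow> 'a set \<Rightarrow> 'a \<Rightarrow> bool" where
  "equidistant_transversal_at A B p \<longleftrightarrow>
     (\<exists>\<alpha>\<in>{0<..<1}. \<exists>\<delta>>0.
        \<forall>a\<in>(A - B) \<inter> ball p \<delta>. \<forall>b\<in>(B - A) \<inter> ball p \<delta>. \<forall>x\<in>ball p \<delta>.
          norm (x - a) = norm (x - b) \<and> x - a \<in> normal_cone A a \<and> x - b \<in> normal_cone B b \<longrightarrow>
          norm ((x - a) + (x - b)) > 2 * \<alpha> * norm (x - a))"

section \<open>Normal cones and projections\<close>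

lemma zero_in_normal_cone: "0 \<in> normal_cone A a"
  by (simp add: normal_cone_def)

lemma normal_cone_scaleR:
  assumes "v \<in> normal_cone A a" "t \<ge> 0"
  shows "t *\<^sub>R v \<in> normal_cone A a"
  using assms by (auto simp: normal_cone_def mult_nonneg_nonpos)

lemma nearest_point_normal:
  fixes A :: "'a::euclidean_space set"
  assumes "convex A" "closed A" "a \<in> A" "infdist x A = dist x a"
  shows "x - a \<in> normal_cone A a"
proof -
  have "\<forall>z\<in>A. dist x a \<le> dist x z"
    using assms(4) infdist_le by metis
  then show ?thesis
    unfolding normal_cone_def using any_closest_point_dot[OF assms(1-3)] by auto
qed

lemma nearest_point_unique:
  fixes A :: "'a::euclidean_space set"
  assumes "convex A" "closed A" "a \<in> A" "b \<in> A"
    and "infdist x A = dist x a" "infdist x A = dist x b"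
  shows "a = b"
proof -
  have "\<forall>z\<in>A. dist x a \<le> dist x z" "\<forall>z\<in>A. dist x b \<le> dist x z"
    using assms(5,6) infdist_le by metis+
  then show ?thesis
    using any_closest_point_unique[OF assms(1-4)] by blast
qed

section \<open>The slope of the larger of the two distances\<close>

text \<open>
  This is Ekeland's variational principle, which in finite dimension needs only a minimiser:
  the penalised function \<open>f y + \<kappa> * dist y x\<close> exceeds \<open>f x\<close> outside a ball around \<open>x\<close>.
\<close>

lemma penalised_minimiser:
  fixes f :: "'a::euclidean_space \<Rightarrow> real"
  assumes cont: "continuous_on UNIV f" and nonneg: "\<And>y. f y \<ge> 0" and "\<kappa> > 0"
  obtains z where "\<kappa> * dist z x \<le> f x" "\<And>y. f z \<le> f y + \<kappa> * dist y z"
proof -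
  define g where "g = (\<lambda>y. f y + \<kappa> * dist y x)"
  let ?K = "cball x (f x / \<kappa>)"
  have "?K \<noteq> {}"
    using nonneg[of x] \<open>\<kappa> > 0\<close> by (simp add: not_less)
  moreover have "continuous_on ?K g"
    unfolding g_def by (intro continuous_intros continuous_on_subset[OF cont]) auto
  ultimately obtain z where z: "z \<in> ?K" "\<And>y. y \<in> ?K \<Longrightarrow> g z \<le> g y"
    using continuous_attains_inf[of ?K g] by auto
  have z_le_x: "g z \<le> f x"
    using z(2)[of x] nonneg[of x] \<open>\<kappa> > 0\<close> by (simp add: g_def)
  have min: "g z \<le> g y" for y
  proof (cases "y \<in> ?K")
    case False
    then have "f x < \<kappa> * dist y x"
      using \<open>\<kappa> > 0\<close> by (simp add: field_simps dist_commute)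
    with z_le_x nonneg[of y] show ?thesis
      by (simp add: g_def)
  qed (use z in auto)
  show thesis
  proof (rule that)
    show "\<kappa> * dist z x \<le> f x"
      using z_le_x nonneg[of z] by (simp add: g_def)
    show "f z \<le> f y + \<kappa> * dist y z" for y
    proof -
      have "\<kappa> * dist y x \<le> \<kappa> * (dist y z + dist z x)"
        using \<open>\<kappa> > 0\<close> by (simp add: dist_triangle)
      with min[of y] show ?thesis
        by (simp add: g_def algebra_simps)
    qed
  qed
qed

text \<open>
  A step of length \<open>t\<close> from \<open>z\<close> towards its projection on the farther set decreases the distance
  to that set by \<open>t\<close>; as long as \<open>t\<close> is at most half the gap, the other set does not become the farther one.
\<close>

lemma slope_bound_imp_infdist_le:
  fixes A B :: "'a::euclidean_space set"
  assumes "closed A" "A \<noteq> {}" "\<kappa> < 1"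
    and slope: "\<And>y. max (infdist z A) (infdist z B) \<le> max (infdist y A) (infdist y B) + \<kappa> * dist y z"
  shows "infdist z A \<le> infdist z B"
proof (rule ccontr)
  assume "\<not> ?thesis"
  then have less: "infdist z B < infdist z A" by simp
  obtain a where a: "a \<in> A" "infdist z A = dist z a"
    using infdist_attains_inf[OF assms(1,2)] by metis
  define r where "r = norm (z - a)"
  have r: "infdist z A = r"
    by (simp add: a(2) r_def dist_norm)
  define t where "t = (r - infdist z B) / 2"
  have t: "0 < t" "t < r"
    using less r infdist_nonneg[of z B] by (auto simp: t_def)
  define y where "y = z - (t / r) *\<^sub>R (z - a)"
  have "dist y z = t"
    using t by (simp add: y_def dist_norm flip: r_def)
  have "y - a = (1 - t / r) *\<^sub>R (z - a)"
    by (simp add: y_def algebra_simps)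
  then have "dist y a = (1 - t / r) * r"
    using t by (simp add: dist_norm flip: r_def)
  also have "\<dots> = r - t"
    using t by (simp add: field_simps)
  finally have "infdist y A \<le> r - t"
    using infdist_le[OF a(1), of y] by simp
  moreover have "infdist y B \<le> infdist z B + t"
    using infdist_triangle[of y B z] \<open>dist y z = t\<close> by simp
  then have "infdist y B \<le> r - t"
    by (simp add: t_def field_simps)
  ultimately have "max (infdist y A) (infdist y B) \<le> r - t"
    by simp
  then have "r \<le> r - t + \<kappa> * t"
    using slope[of y] less unfolding r \<open>dist y z = t\<close> by linarith
  with t \<open>\<kappa> < 1\<close> show False
    by simp
qed

lemma slope_bound_imp_equal_infdist:
  fixes A B :: "'a::euclidean_space set"
  assumes "closed A" "A \<noteq> {}" "closed B" "B \<noteq> {}" "\<kappa> < 1"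
    and slope: "\<And>y. max (infdist z A) (infdist z B) \<le> max (infdist y A) (infdist y B) + \<kappa> * dist y z"
  shows "infdist z A = infdist z B"
proof (rule antisym)
  show "infdist z A \<le> infdist z B"
    using slope_bound_imp_infdist_le[OF assms(1,2,5) slope] .
  show "infdist z B \<le> infdist z A"
    using slope_bound_imp_infdist_le[OF assms(3,4,5), of z A] slope by (simp add: max.commute)
qed

text \<open>
  The step goes against \<open>g = (z - a) + (z - b)\<close>. Because \<open>z - a\<close> and \<open>z - b\<close> have the same length,
  each has inner product \<open>norm g ^ 2 / 2\<close> with \<open>g\<close>, so the distances to \<open>a\<close> and \<open>b\<close> remain
  equal and both decrease, to first order, at rate \<open>norm g / (2 * norm (z - a))\<close>.
\<close>

lemma slope_bound_imp_opposed:
  fixes A B :: "'a::euclidean_space set"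
  assumes "a \<in> A" "b \<in> B" "0 < \<kappa>" "\<kappa> < 1"
    and "norm (z - a) = r" "norm (z - b) = r" "0 < r"
    and slope: "\<And>y. r \<le> max (infdist y A) (infdist y B) + \<kappa> * dist y z"
  shows "norm ((z - a) + (z - b)) \<le> 2 * \<kappa> * r"
proof (rule ccontr)
  define g where "g = (z - a) + (z - b)"
  define G where "G = norm g"
  assume "\<not> ?thesis"
  then have G: "2 * \<kappa> * r < G"
    by (simp add: G_def g_def)
  have "0 < G"
    using G assms(3,7) by (smt (verit) mult_pos_pos)
  have "G \<le> 2 * r"
    using norm_triangle_ineq[of "z - a" "z - b"] assms(5,6) by (simp add: G_def g_def)
  have dots: "(z - a) \<bullet> (z - a) = r\<^sup>2" "(z - b) \<bullet> (z - b) = r\<^sup>2"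
    using assms(5,6) by (simp_all flip: power2_norm_eq_inner)
  have GG: "g \<bullet> g = G\<^sup>2"
    by (simp add: G_def power2_norm_eq_inner)
  have sum: "(z - a) \<bullet> g + (z - b) \<bullet> g = G\<^sup>2"
    by (simp add: GG[symmetric] g_def inner_add_left)
  have eq: "(z - a) \<bullet> g = (z - b) \<bullet> g"
    unfolding g_def inner_add_right using dots inner_commute[of "z - a" "z - b"] by linarith
  \<comment> \<open>This choice makes \<open>G * (1 - t)\<close> the midpoint between \<open>G\<close> and \<open>2 * \<kappa> * r\<close>.\<close>
  define t where "t = (1 - 2 * \<kappa> * r / G) / 2"
  have "0 < t" "t \<le> 1 / 2"
    using G \<open>0 < G\<close> assms(3,7) by (auto simp: t_def field_simps)
  define y where "y = z - t *\<^sub>R g"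
  have step: "(norm (w - t *\<^sub>R g))\<^sup>2 = r\<^sup>2 - t * G\<^sup>2 + t\<^sup>2 * G\<^sup>2"
    if "w \<bullet> w = r\<^sup>2" "w \<bullet> g = G\<^sup>2 / 2" for w
  proof -
    have "(norm (w - t *\<^sub>R g))\<^sup>2 = w \<bullet> w - 2 * t * (w \<bullet> g) + t\<^sup>2 * (g \<bullet> g)"
      unfolding power2_norm_eq_inner inner_diff_left inner_diff_right
      using inner_commute[of g w] by (simp add: power2_eq_square)
    then show ?thesis
      using that by (simp add: GG)
  qed
  have na: "(dist y a)\<^sup>2 = r\<^sup>2 - t * G\<^sup>2 + t\<^sup>2 * G\<^sup>2"
    using step[of "z - a"] dots(1) eq sum by (simp add: y_def dist_norm algebra_simps)
  have nb: "(dist y b)\<^sup>2 = r\<^sup>2 - t * G\<^sup>2 + t\<^sup>2 * G\<^sup>2"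
    using step[of "z - b"] dots(2) eq sum by (simp add: y_def dist_norm algebra_simps)
  have "dist y a = dist y b"
    using na nb power2_eq_iff_nonneg[of "dist y a" "dist y b"] by simp
  moreover have "dist y z = t * G"
    using \<open>0 < t\<close> by (simp add: y_def dist_norm G_def)
  ultimately have lower: "r - \<kappa> * (t * G) \<le> dist y a"
    using slope[of y] infdist_le[OF assms(1), of y] infdist_le[OF assms(2), of y] by simp
  have "t * G \<le> 1 / 2 * (2 * r)"
    using \<open>t \<le> 1 / 2\<close> \<open>G \<le> 2 * r\<close> \<open>0 < G\<close> by (intro mult_mono) auto
  then have "\<kappa> * (t * G) \<le> 1 * r"
    using assms(3,4,7) \<open>0 < t\<close> \<open>0 < G\<close> by (intro mult_mono) auto
  then have "(r - \<kappa> * (t * G))\<^sup>2 \<le> (dist y a)\<^sup>2"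
    using lower by (intro power_mono) auto
  then have "(t * G) * (G * (1 - t)) \<le> (t * G) * (2 * \<kappa> * r) - (\<kappa> * (t * G))\<^sup>2"
    unfolding na by (simp add: power2_eq_square algebra_simps)
  also have "\<dots> \<le> (t * G) * (2 * \<kappa> * r)"
    by simp
  finally have "G * (1 - t) \<le> 2 * \<kappa> * r"
    using \<open>0 < t\<close> \<open>0 < G\<close> by simp
  moreover have "G * (1 - t) = (G + 2 * \<kappa> * r) / 2"
    using \<open>0 < G\<close> by (simp add: t_def field_simps)
  ultimately show False
    using G by simp
qed

section \<open>From the equidistant condition to subtransversality\<close>

lemma equidistant_transversal_imp_subtransversal:
  fixes A B :: "'a::euclidean_space set"
  assumes "closed A" "convex A" "closed B" "convex B" "p \<in> A \<inter> B"
    and "equidistant_transversal_at A B p"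
  shows "subtransversal_at A B p"
proof -
  obtain \<alpha> \<delta> where \<alpha>: "0 < \<alpha>" "\<alpha> < 1" and "0 < \<delta>"
    and far: "\<And>a b x. \<lbrakk>a \<in> A - B; a \<in> ball p \<delta>; b \<in> B - A; b \<in> ball p \<delta>; x \<in> ball p \<delta>;
        norm (x - a) = norm (x - b); x - a \<in> normal_cone A a; x - b \<in> normal_cone B b\<rbrakk>
      \<Longrightarrow> norm ((x - a) + (x - b)) > 2 * \<alpha> * norm (x - a)"
    using assms(6) unfolding equidistant_transversal_at_def by fastforce
  have ne: "A \<noteq> {}" "B \<noteq> {}"
    using assms(5) by auto
  define f where "f = (\<lambda>y. max (infdist y A) (infdist y B))"
  have "continuous_on UNIV f"
    unfolding f_def by (intro continuous_intros)
  have f_nonneg: "f y \<ge> 0" for y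
    by (simp add: f_def infdist_nonneg le_max_iff_disj)
  \<comment> \<open>As \<open>dist z x \<le> f x / \<alpha>\<close>, this radius keeps \<open>z\<close> within \<open>\<delta> / 2\<close> of \<open>p\<close>, hence its projections
    within \<open>\<delta>\<close>.\<close>
  have "\<alpha> * infdist x (A \<inter> B) \<le> f x" if x: "x \<in> ball p (\<delta> * \<alpha> / 4)" for x
  proof (rule ccontr)
    assume "\<not> ?thesis"
    then have small: "f x < \<alpha> * infdist x (A \<inter> B)" by simp
    obtain z where z: "\<alpha> * dist z x \<le> f x" and slope: "\<And>y. f z \<le> f y + \<alpha> * dist y z"
      using penalised_minimiser[OF \<open>continuous_on UNIV f\<close> f_nonneg \<alpha>(1)] by metis
    have "\<alpha> * dist z x < \<alpha> * infdist x (A \<inter> B)"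
      using z small by linarith
    then have "dist x z < infdist x (A \<inter> B)"
      using \<alpha>(1) by (simp add: dist_commute)
    then have "z \<notin> A \<inter> B"
      using infdist_le[of z "A \<inter> B" x] by auto
    define r where "r = infdist z A"
    have r: "infdist z A = r" "infdist z B = r"
      using slope_bound_imp_equal_infdist[OF assms(1) ne(1) assms(3) ne(2) \<alpha>(2) slope[unfolded f_def]]
      by (simp_all add: r_def)
    have "0 < r"
      using \<open>z \<notin> A \<inter> B\<close> r ne assms(1,3) infdist_nonneg[of z A]
        in_closed_iff_infdist_zero[of A z] in_closed_iff_infdist_zero[of B z] by force
    obtain a where a: "a \<in> A" "infdist z A = dist z a"
      using infdist_attains_inf[OF assms(1) ne(1)] by metis
    obtain b where b: "b \<in> B" "infdist z B = dist z b"
      using infdist_attains_inf[OF assms(3) ne(2)] by metis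
    have nr: "norm (z - a) = r" "norm (z - b) = r"
      using a b r by (simp_all add: dist_norm)
    have opposed: "norm ((z - a) + (z - b)) \<le> 2 * \<alpha> * r"
      using slope_bound_imp_opposed[OF a(1) b(1) \<alpha> nr \<open>0 < r\<close>] slope r by (simp add: f_def)
    have "a \<noteq> b"
    proof
      assume "a = b"
      then have "(z - a) + (z - b) = 2 *\<^sub>R (z - a)"
        by (simp add: scaleR_2)
      then show False
        using opposed nr \<alpha> \<open>0 < r\<close> by simp
    qed
    \<comment> \<open>A common projection would be excluded by uniqueness, as the two distances agree.\<close>
    have "a \<notin> B"
      using nearest_point_unique[OF assms(4,3) _ b(1) _ b(2)] a r \<open>a \<noteq> b\<close> by auto
    have "b \<notin> A"
      using nearest_point_unique[OF assms(2,1) a(1) _ a(2)] b r \<open>a \<noteq> b\<close> by auto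
    have "f x \<le> dist x p"
      using infdist_le[of p A x] infdist_le[of p B x] assms(5) by (simp add: f_def)
    then have "\<alpha> * dist z x \<le> \<alpha> * (\<delta> / 4)"
      using z x by (simp add: dist_commute mult.commute)
    then have "dist z x \<le> \<delta> / 4"
      using \<alpha>(1) by simp
    moreover have "dist x p < \<delta> / 4"
    proof -
      have "\<delta> * \<alpha> / 4 \<le> \<delta> / 4"
        using \<alpha> \<open>0 < \<delta>\<close> by simp
      with x show ?thesis
        by (simp add: dist_commute)
    qed
    ultimately have zp: "dist z p < \<delta> / 2"
      using dist_triangle[of z p x] by linarith
    have "r \<le> dist z p"
      using infdist_le[of p A z] assms(5) r by simp
    moreover have "dist z p < \<delta>"
      using zp zero_le_dist[of z p] by linarith
    ultimately have "a \<in> ball p \<delta>" "b \<in> ball p \<delta>" "z \<in> ball p \<delta>"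
      using zp dist_triangle[of p a z] dist_triangle[of p b z] a b r
      by (auto simp: dist_commute)
    then have "norm ((z - a) + (z - b)) > 2 * \<alpha> * norm (z - a)"
      using a b \<open>a \<notin> B\<close> \<open>b \<notin> A\<close> nr assms(1-4)
      by (intro far) (auto intro: nearest_point_normal)
    with opposed nr show False
      by simp
  qed
  moreover have "\<delta> * \<alpha> / 4 > 0"
    using \<alpha> \<open>0 < \<delta>\<close> by simp
  ultimately show ?thesis
    unfolding subtransversal_at_def f_def using \<alpha>
    by (intro bexI[of _ \<alpha>] exI[of _ "\<delta> * \<alpha> / 4"]) auto
qed

section \<open>Both kinds of intrinsic transversality imply the equidistant condition\<close>

text \<open>
  The admissible pair of normals to which either condition is applied consists of the two unit
  vectors \<open>(x - a) / r\<close> and \<open>(x - b) / r\<close>, halved so that their norms sum to 1.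
\<close>

lemma halved_unit_normal:
  fixes x a :: "'a::euclidean_space"
  assumes "x - a \<in> normal_cone A a" "x \<noteq> a"
  defines "v \<equiv> (1 / (2 * norm (x - a))) *\<^sub>R (x - a)"
  shows "v \<in> normal_cone A a - {0}" "norm v = 1 / 2" "v \<bullet> (x - a) = norm v * norm (x - a)"
proof -
  show "norm v = 1 / 2"
    using assms(2) by (simp add: v_def)
  then show "v \<bullet> (x - a) = norm v * norm (x - a)"
    using assms(2) by (simp add: v_def dot_square_norm power2_eq_square)
  show "v \<in> normal_cone A a - {0}"
    using normal_cone_scaleR[OF assms(1), of "1 / (2 * norm (x - a))"] assms(2)
    by (simp add: v_def)
qed

lemma norm_halved_units_gt_iff:
  fixes u w :: "'a::real_normed_vector"
  assumes "0 < r"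
  shows "norm ((1 / (2 * r)) *\<^sub>R u + (1 / (2 * r)) *\<^sub>R w) > \<alpha> \<longleftrightarrow> norm (u + w) > 2 * \<alpha> * r"
proof -
  have "norm ((1 / (2 * r)) *\<^sub>R u + (1 / (2 * r)) *\<^sub>R w) = norm (u + w) / (2 * r)"
    using assms by (simp flip: scaleR_add_right)
  then show ?thesis
    using assms by (simp add: pos_less_divide_eq mult.commute mult.left_commute)
qed

lemma intrinsically_imp_equidistant_transversal:
  assumes "intrinsically_transversal_at A B p"
  shows "equidistant_transversal_at A B p"
proof -
  obtain \<alpha> \<delta> where \<alpha>: "\<alpha> \<in> {0<..<1}" and "0 < \<delta>"
    and it: "\<And>a b x v1 v2. \<lbrakk>a \<in> (A - B) \<inter> ball p \<delta>; b \<in> (B - A) \<inter> ball p \<delta>; x \<in> ball p \<delta>;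
        x \<noteq> a; x \<noteq> b; 1 - \<delta> < norm (x - a) / norm (x - b); norm (x - a) / norm (x - b) < 1 + \<delta>;
        v1 \<in> normal_cone A a - {0}; v2 \<in> normal_cone B b - {0}; norm v1 + norm v2 = 1;
        (v1 \<bullet> (x - a)) / (norm v1 * norm (x - a)) > 1 - \<delta>;
        (v2 \<bullet> (x - b)) / (norm v2 * norm (x - b)) > 1 - \<delta>\<rbrakk> \<Longrightarrow> norm (v1 + v2) > \<alpha>"
    using assms unfolding intrinsically_transversal_at_def by metis
  have "norm ((x - a) + (x - b)) > 2 * \<alpha> * norm (x - a)"
    if ab: "a \<in> (A - B) \<inter> ball p \<delta>" "b \<in> (B - A) \<inter> ball p \<delta>" and x: "x \<in> ball p \<delta>"
      and eq: "norm (x - a) = norm (x - b)"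
      and nc: "x - a \<in> normal_cone A a" "x - b \<in> normal_cone B b" for a b x
  proof -
    have ne: "x \<noteq> a" "x \<noteq> b"
      using ab eq by auto
    define v1 where "v1 = (1 / (2 * norm (x - a))) *\<^sub>R (x - a)"
    define v2 where "v2 = (1 / (2 * norm (x - b))) *\<^sub>R (x - b)"
    note h = halved_unit_normal[OF nc(1) ne(1), folded v1_def]
      halved_unit_normal[OF nc(2) ne(2), folded v2_def]
    have "norm (v1 + v2) > \<alpha>"
      using \<open>0 < \<delta>\<close> eq ne by (intro it[OF ab x ne _ _ h(1) h(4)]) (simp_all add: h)
    then show ?thesis
      using norm_halved_units_gt_iff[of "norm (x - a)" \<alpha> "x - a" "x - b"] ne eq
      by (simp add: v1_def v2_def)
  qed
  with \<alpha> \<open>0 < \<delta>\<close> show ?thesis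
    unfolding equidistant_transversal_at_def by blast
qed

lemma weakly_intrinsically_imp_equidistant_transversal:
  assumes "weakly_intrinsically_transversal_at A B p"
  shows "equidistant_transversal_at A B p"
proof -
  obtain \<alpha> \<delta> where \<alpha>: "\<alpha> \<in> {0<..<1}" and "0 < \<delta>"
    and wit: "\<And>a b x v1 v2. \<lbrakk>a \<in> (A - B) \<inter> ball p \<delta>; b \<in> (B - A) \<inter> ball p \<delta>; x \<in> ball p \<delta>;
        norm (x - a) = norm (x - b); v1 \<in> normal_cone A a; v2 \<in> normal_cone B b;
        norm v1 + norm v2 = 1; v1 \<bullet> (x - a) = norm v1 * norm (x - a);
        v2 \<bullet> (x - b) = norm v2 * norm (x - b)\<rbrakk> \<Longrightarrow> norm (v1 + v2) > \<alpha>"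
    using assms unfolding weakly_intrinsically_transversal_at_def
  proof (elim bexE exE conjE, goal_cases)
    case (1 \<alpha> \<delta>)
    show ?case
    proof (rule 1(1)[OF 1(2,3)], goal_cases)
      case prems: (1 a b x v1 v2)
      from 1(4)[THEN bspec, OF prems(1), THEN bspec, OF prems(2), THEN bspec, OF prems(3),
          THEN mp, OF prems(4)]
      show ?case
      proof (elim exE conjE, goal_cases)
        case near: (1 \<epsilon>)
        \<comment> \<open>The perturbed points \<open>a'\<close>, \<open>x1\<close> and \<open>b'\<close>, \<open>x2\<close> are taken to be \<open>a\<close> and \<open>b\<close> themselves.\<close>
        have "a \<in> A \<inter> ball a \<epsilon>" "b \<in> B \<inter> ball b \<epsilon>" "a \<in> ball a \<epsilon>" "b \<in> ball b \<epsilon>"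
          using prems(1,2) near(1) by auto
        note near(2)[THEN bspec, OF this(1), THEN bspec, OF this(2), THEN bspec, OF this(3),
            THEN bspec, OF this(4), THEN mp, OF prems(4)]
        then show ?case
          using prems(5-9) 1(3) by simp
      qed
    qed
  qed
  have "norm ((x - a) + (x - b)) > 2 * \<alpha> * norm (x - a)"
    if ab: "a \<in> (A - B) \<inter> ball p \<delta>" "b \<in> (B - A) \<inter> ball p \<delta>" and x: "x \<in> ball p \<delta>"
      and eq: "norm (x - a) = norm (x - b)"
      and nc: "x - a \<in> normal_cone A a" "x - b \<in> normal_cone B b" for a b x
  proof -
    have ne: "x \<noteq> a" "x \<noteq> b"
      using ab eq by auto
    define v1 where "v1 = (1 / (2 * norm (x - a))) *\<^sub>R (x - a)"
    define v2 where "v2 = (1 / (2 * norm (x - b))) *\<^sub>R (x - b)"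
    note h = halved_unit_normal[OF nc(1) ne(1), folded v1_def]
      halved_unit_normal[OF nc(2) ne(2), folded v2_def]
    have "norm (v1 + v2) > \<alpha>"
      using h(1,2,4,5) by (intro wit[OF ab x eq _ _ _ h(3,6)]) auto
    then show ?thesis
      using norm_halved_units_gt_iff[of "norm (x - a)" \<alpha> "x - a" "x - b"] ne eq
      by (simp add: v1_def v2_def)
  qed
  with \<alpha> \<open>0 < \<delta>\<close> show ?thesis
    unfolding equidistant_transversal_at_def by blast
qed

section \<open>Subtransversality implies both kinds of intrinsic transversality\<close>

lemma subtransversal_atE:
  fixes A B :: "'a::euclidean_space set"
  assumes "closed A" "closed B" "p \<in> A \<inter> B" "subtransversal_at A B p"
  obtains \<alpha> \<delta> where "0 < \<alpha>" "\<alpha> < 1" "0 < \<delta>"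
    "\<And>x a b. \<lbrakk>x \<in> ball p \<delta>; a \<in> A; b \<in> B\<rbrakk> \<Longrightarrow>
       \<exists>c\<in>A \<inter> B. \<alpha> * norm (x - c) \<le> max (norm (x - a)) (norm (x - b))"
proof -
  obtain \<alpha> \<delta> where "\<alpha> \<in> {0<..<1}" and "0 < \<delta>"
    and sub: "\<forall>x\<in>ball p \<delta>. \<alpha> * infdist x (A \<inter> B) \<le> max (infdist x A) (infdist x B)"
    using assms(4) unfolding subtransversal_at_def by blast
  then have \<alpha>: "0 < \<alpha>" "\<alpha> < 1"
    by auto
  have "\<exists>c\<in>A \<inter> B. \<alpha> * norm (x - c) \<le> max (norm (x - a)) (norm (x - b))"
    if "x \<in> ball p \<delta>" "a \<in> A" "b \<in> B" for x a b
  proof -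
    obtain c where c: "c \<in> A \<inter> B" "infdist x (A \<inter> B) = dist x c"
      using infdist_attains_inf[of "A \<inter> B" x] assms(1-3) by auto
    have "infdist x A \<le> norm (x - a)" "infdist x B \<le> norm (x - b)"
      using infdist_le that(2,3) by (metis dist_norm)+
    moreover have "\<alpha> * norm (x - c) \<le> max (infdist x A) (infdist x B)"
      using sub[rule_format, OF that(1)] c(2) by (simp add: dist_norm)
    ultimately have "\<alpha> * norm (x - c) \<le> max (norm (x - a)) (norm (x - b))"
      by linarith
    with c(1) show ?thesis by blast
  qed
  with \<alpha> \<open>0 < \<delta>\<close> show thesis
    using that by blast
qed

text \<open>
  At tolerance \<open>1 / 2\<close> both distances are at least half of the larger one, \<open>M\<close>, and both cosines are
  at least \<open>1 / 2\<close>, so that \<open>(v1 + v2) \<bullet> (x - c) \<ge> M / 4\<close>, while \<open>norm (x - c) \<le> M / \<alpha>\<close>.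
\<close>

lemma subtransversal_imp_intrinsically_transversal:
  fixes A B :: "'a::euclidean_space set"
  assumes "closed A" "closed B" "p \<in> A \<inter> B" "subtransversal_at A B p"
  shows "intrinsically_transversal_at A B p"
proof -
  obtain \<alpha> \<delta>0 where \<alpha>: "0 < \<alpha>" "\<alpha> < 1" and "0 < \<delta>0"
    and near: "\<And>x a b. \<lbrakk>x \<in> ball p \<delta>0; a \<in> A; b \<in> B\<rbrakk> \<Longrightarrow>
       \<exists>c\<in>A \<inter> B. \<alpha> * norm (x - c) \<le> max (norm (x - a)) (norm (x - b))"
    by (rule subtransversal_atE[OF assms]) (rule that)
  define \<delta> where "\<delta> = min \<delta>0 (1 / 2)"
  have \<delta>: "0 < \<delta>" "\<delta> \<le> \<delta>0" "\<delta> \<le> 1 / 2"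
    using \<open>0 < \<delta>0\<close> by (auto simp: \<delta>_def)
  have "norm (v1 + v2) > \<alpha> / 8"
    if ab: "a \<in> A" "b \<in> B" and x: "x \<in> ball p \<delta>" "x \<noteq> a" "x \<noteq> b"
      and ratio: "1 - \<delta> < norm (x - a) / norm (x - b)" "norm (x - a) / norm (x - b) < 1 + \<delta>"
      and v: "v1 \<in> normal_cone A a" "v2 \<in> normal_cone B b" "v1 \<noteq> 0" "v2 \<noteq> 0"
        "norm v1 + norm v2 = 1"
      and cosine: "(v1 \<bullet> (x - a)) / (norm v1 * norm (x - a)) > 1 - \<delta>"
        "(v2 \<bullet> (x - b)) / (norm v2 * norm (x - b)) > 1 - \<delta>"
    for a b x v1 v2
  proof (rule ccontr)
    assume "\<not> ?thesis"
    then have small: "norm (v1 + v2) \<le> \<alpha> / 8" by simp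
    define M where "M = max (norm (x - a)) (norm (x - b))"
    have "0 < M"
      using x by (simp add: M_def less_max_iff_disj)
    obtain c where c: "c \<in> A" "c \<in> B" "\<alpha> * norm (x - c) \<le> M"
      using near[of x a b] ab x \<delta> by (auto simp: M_def)
    have "1 / 2 < norm (x - a) / norm (x - b)" "norm (x - a) / norm (x - b) < 2"
      using ratio \<delta> by linarith+
    then have half: "M / 2 \<le> norm (x - a)" "M / 2 \<le> norm (x - b)"
      using x by (auto simp: M_def field_simps max_def)
    have bound: "norm v * (M / 4) \<le> v \<bullet> (x - c)"
      if "v \<in> normal_cone S s" "v \<noteq> 0" "c \<in> S" "x \<noteq> s" "M / 2 \<le> norm (x - s)"
        "(v \<bullet> (x - s)) / (norm v * norm (x - s)) > 1 - \<delta>" for S s v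
    proof -
      have "1 / 2 < (v \<bullet> (x - s)) / (norm v * norm (x - s))"
        using that(6) \<delta> by linarith
      then have "norm v * norm (x - s) / 2 \<le> v \<bullet> (x - s)"
        using that(2,4) by (simp add: field_simps)
      moreover have "norm v * (M / 2) \<le> norm v * norm (x - s)"
        using that(5) by (intro mult_left_mono) auto
      moreover have "v \<bullet> (c - s) \<le> 0"
        using that(1,3) by (simp add: normal_cone_def)
      moreover have "v \<bullet> (x - c) = v \<bullet> (x - s) - v \<bullet> (c - s)"
        by (simp add: inner_diff_right)
      ultimately show ?thesis
        by simp
    qed
    have "(norm v1 + norm v2) * (M / 4) \<le> (v1 + v2) \<bullet> (x - c)"
      using bound[OF v(1,3) c(1) x(2) half(1) cosine(1)]
        bound[OF v(2,4) c(2) x(3) half(2) cosine(2)]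
      by (simp add: inner_add_left distrib_right)
    also have "\<dots> \<le> norm (v1 + v2) * norm (x - c)"
      by (rule norm_cauchy_schwarz)
    also have "\<dots> \<le> \<alpha> / 8 * norm (x - c)"
      using small by (intro mult_right_mono) auto
    also have "\<dots> \<le> M / 8"
      using c(3) by simp
    finally show False
      using v(5) \<open>0 < M\<close> by simp
  qed
  moreover have "\<alpha> / 8 \<in> {0<..<1}"
    using \<alpha> by simp
  ultimately show ?thesis
    unfolding intrinsically_transversal_at_def using \<delta>(1)
    by (intro bexI[of _ "\<alpha> / 8"] exI[of _ \<delta>]) auto
qed

text \<open>
  With \<open>r\<close> the common distance from \<open>x\<close> to \<open>a\<close> and \<open>b\<close>, moving the base points by at most
  \<open>\<epsilon> = r / 20\<close> costs at most \<open>5 * \<epsilon>\<close> in the lower bound for \<open>(v1 + v2) \<bullet> (x - c)\<close>, and moving the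
  two normals by at most \<open>\<delta> \<le> \<alpha> / 24\<close> costs at most \<open>2 * \<delta> * (3 * r / \<alpha>)\<close>. The bound therefore
  stays at least \<open>r / 2\<close>.
\<close>

lemma subtransversal_imp_weakly_intrinsically_transversal:
  fixes A B :: "'a::euclidean_space set"
  assumes "closed A" "closed B" "p \<in> A \<inter> B" "subtransversal_at A B p"
  shows "weakly_intrinsically_transversal_at A B p"
proof -
  obtain \<alpha> \<delta>0 where \<alpha>: "0 < \<alpha>" "\<alpha> < 1" and "0 < \<delta>0"
    and near: "\<And>x a b. \<lbrakk>x \<in> ball p \<delta>0; a \<in> A; b \<in> B\<rbrakk> \<Longrightarrow>
       \<exists>c\<in>A \<inter> B. \<alpha> * norm (x - c) \<le> max (norm (x - a)) (norm (x - b))"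
    by (rule subtransversal_atE[OF assms]) (rule that)
  define \<delta> where "\<delta> = min \<delta>0 (\<alpha> / 24)"
  have \<delta>: "0 < \<delta>" "\<delta> \<le> \<delta>0" "\<delta> \<le> \<alpha> / 24"
    using \<open>0 < \<delta>0\<close> \<alpha> by (auto simp: \<delta>_def)
  have main: "norm (v1 + v2) > \<alpha> / 4"
    if "a \<noteq> b" and ab: "a \<in> A" "b \<in> B" and x: "x \<in> ball p \<delta>"
      and r: "norm (x - a) = r" "norm (x - b) = r"
      and a': "a' \<in> ball a (r / 20)" and b': "b' \<in> ball b (r / 20)"
      and x1: "x1 \<in> ball a (r / 20)" and x2: "x2 \<in> ball b (r / 20)"
      and x12: "norm (x - x1) = norm (x - x2)"
      and v: "infdist v1 (normal_cone A a') < \<delta>" "infdist v2 (normal_cone B b') < \<delta>"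
        "norm v1 + norm v2 = 1"
      and aligned: "v1 \<bullet> (x - x1) = norm v1 * norm (x - x1)"
        "v2 \<bullet> (x - x2) = norm v2 * norm (x - x2)"
    for a b x r a' b' x1 x2 v1 v2
  proof (rule ccontr)
    assume "\<not> ?thesis"
    then have small: "norm (v1 + v2) \<le> \<alpha> / 4" by simp
    have "0 < r"
      using r \<open>a \<noteq> b\<close> by auto
    obtain c where c: "c \<in> A" "c \<in> B" "\<alpha> * norm (x - c) \<le> r"
      using near[of x a b] ab x \<delta> r by auto
    have bound: "norm v * norm (x - y) - r / 10 - r / 8 \<le> v \<bullet> (x - c)"
      if close: "infdist v (normal_cone S s') < \<delta>" and "c \<in> S" "norm (x - s) = r"
        "s' \<in> ball s (r / 20)" "y \<in> ball s (r / 20)" "v \<bullet> (x - y) = norm v * norm (x - y)"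
        "norm v \<le> 1"
      for S s s' v y
    proof -
      have "normal_cone S s' \<noteq> {}"
        using zero_in_normal_cone by blast
      then obtain n where n: "n \<in> normal_cone S s'" "dist v n < \<delta>"
        using cInf_lessD[of "dist v ` normal_cone S s'" \<delta>] close
        by (auto simp: infdist_notempty)
      have "v \<bullet> (x - c) = v \<bullet> (x - y) + v \<bullet> (y - s') - n \<bullet> (c - s') + (v - n) \<bullet> (s' - c)"
        by (simp add: inner_diff_left inner_diff_right)
      moreover have "n \<bullet> (c - s') \<le> 0"
        using n(1) that(2) by (simp add: normal_cone_def)
      moreover have "v \<bullet> (y - s') \<ge> - (r / 10)"
      proof -
        have "norm (y - s') \<le> r / 10"
          using that(4,5) dist_triangle[of y s' s] by (simp add: dist_norm norm_minus_commute)
        then have "norm v * norm (y - s') \<le> 1 * (r / 10)"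
          using that(7) by (intro mult_mono) auto
        with Cauchy_Schwarz_ineq2[of v "y - s'"] show ?thesis
          by linarith
      qed
      moreover have "(v - n) \<bullet> (s' - c) \<ge> - (r / 8)"
      proof -
        have "norm (s' - c) \<le> norm (s' - s) + norm (s - x) + norm (x - c)"
          using norm_triangle_ineq[of "s' - s" "s - x"] norm_triangle_ineq[of "s' - x" "x - c"]
          by simp
        then have "norm (s' - c) \<le> 2 * r + norm (x - c)"
          using that(3,4) \<open>0 < r\<close> by (simp add: dist_norm norm_minus_commute)
        then have "\<alpha> * norm (s' - c) \<le> \<alpha> * (2 * r + norm (x - c))"
          using \<alpha> by (intro mult_left_mono) auto
        also have "\<dots> \<le> 2 * r + r"
        proof -
          have "\<alpha> * (2 * r) \<le> 1 * (2 * r)"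
            using \<alpha> \<open>0 < r\<close> by (intro mult_right_mono) auto
          with c(3) show ?thesis
            by (simp add: distrib_left)
        qed
        finally have far: "\<alpha> * norm (s' - c) \<le> 3 * r"
          by simp
        have "norm (v - n) * norm (s' - c) \<le> \<alpha> / 24 * norm (s' - c)"
          using n(2) \<delta>(3) by (intro mult_right_mono) (auto simp: dist_norm)
        also have "\<dots> \<le> r / 8"
          using far by simp
        finally show ?thesis
          using Cauchy_Schwarz_ineq2[of "v - n" "s' - c"] by linarith
      qed
      ultimately show ?thesis
        using that(6) by linarith
    qed
    have v_le: "norm v1 \<le> 1" "norm v2 \<le> 1"
      using v(3) norm_ge_zero[of v1] norm_ge_zero[of v2] by linarith+
    have "norm v1 * norm (x - x1) + norm v2 * norm (x - x2) = norm (x - x1)"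
      using v(3) x12 by (metis distrib_right mult_1)
    then have "norm (x - x1) - r / 5 - r / 4 \<le> (v1 + v2) \<bullet> (x - c)"
      using bound[OF v(1) c(1) r(1) a' x1 aligned(1) v_le(1)]
        bound[OF v(2) c(2) r(2) b' x2 aligned(2) v_le(2)]
      by (simp add: inner_add_left)
    also have "\<dots> \<le> norm (v1 + v2) * norm (x - c)"
      by (rule norm_cauchy_schwarz)
    also have "\<dots> \<le> \<alpha> / 4 * norm (x - c)"
      using small by (intro mult_right_mono) auto
    also have "\<dots> \<le> r / 4"
      using c(3) by simp
    finally have "norm (x - x1) \<le> 7 / 10 * r"
      by simp
    moreover have "r \<le> norm (x - x1) + r / 20"
      using x1 r(1) norm_triangle_ineq[of "x - x1" "x1 - a"]
      by (simp add: dist_norm norm_minus_commute)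
    ultimately show False
      using \<open>0 < r\<close> by simp
  qed
  show ?thesis
    unfolding weakly_intrinsically_transversal_at_def
  proof (rule bexI[of _ "\<alpha> / 4"], rule exI[of _ \<delta>], intro conjI ballI impI)
    fix a b x
    assume a: "a \<in> (A - B) \<inter> ball p \<delta>" and b: "b \<in> (B - A) \<inter> ball p \<delta>"
      and x: "x \<in> ball p \<delta>" and eq: "norm (x - a) = norm (x - b)"
    have "a \<noteq> b" "a \<in> A" "b \<in> B"
      using a b by auto
    note m = main[OF \<open>a \<noteq> b\<close> \<open>a \<in> A\<close> \<open>b \<in> B\<close> x refl eq[symmetric]]
    have pos: "norm (x - a) / 20 > 0"
      using \<open>a \<noteq> b\<close> eq by auto
    show "\<exists>\<epsilon>>0.
             \<forall>a'\<in>A \<inter> ball a \<epsilon>. \<forall>b'\<in>B \<inter> ball b \<epsilon>. \<forall>x1\<in>ball a \<epsilon>. \<forall>x2\<in>ball b \<epsilon>.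
               norm (x - x1) = norm (x - x2) \<longrightarrow>
               (\<forall>v1 v2.
                  infdist v1 (normal_cone A a') < \<delta> \<and> infdist v2 (normal_cone B b') < \<delta> \<and>
                  norm v1 + norm v2 = 1 \<and>
                  v1 \<bullet> (x - x1) = norm v1 * norm (x - x1) \<and>
                  v2 \<bullet> (x - x2) = norm v2 * norm (x - x2) \<longrightarrow>
                  norm (v1 + v2) > \<alpha> / 4)"
      by (intro exI[of _ "norm (x - a) / 20"] conjI ballI impI allI pos)
        (elim conjE IntE, rule m, assumption+)
  qed (use \<alpha> \<delta> in auto)
qed

section \<open>The equivalence\<close>

theorem corollary4:
  fixes A B :: "'a::euclidean_space set" and p :: 'a
  assumes "closed A" and "convex A"
    and "closed B" and "convex B"
    and "p \<in> A \<inter> B"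
  shows "(intrinsically_transversal_at A B p \<longleftrightarrow> weakly_intrinsically_transversal_at A B p) \<and>
         (weakly_intrinsically_transversal_at A B p \<longleftrightarrow> subtransversal_at A B p)"
  using equidistant_transversal_imp_subtransversal[OF assms]
    intrinsically_imp_equidistant_transversal
    weakly_intrinsically_imp_equidistant_transversal
    subtransversal_imp_intrinsically_transversal[OF assms(1,3,5)]
    subtransversal_imp_weakly_intrinsically_transversal[OF assms(1,3,5)]
  by blast

end
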